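(* Let $\alpha,\beta\in\mathbb{Z}$, $\alpha<\beta$. Let $g$ be a decreasing concave real-valued function on $[\alpha,\beta]$ which is Lipschitz with a constant $c\in(0,1)$, and assume additionally that $$\lfloor g(\alpha)\rfloor=\lfloor g(p)\rfloor>\lfloor g(p+1)\rfloor$$ for some integer $p\in[\alpha,\beta)$. Then $$\mathbf{T}(g,\alpha,\beta)\le\int_\alpha^\beta g(z)\,dz-\frac{1-c}{2}(\beta-p).$$
   Context: For integers $a<b$ and $g:[a,b]\to\mathbb{R}$, the trapezoidal floor sum of $g$ on $[a,b]$ is $$\mathbf{T}(g,a,b)=\frac12\sum_{m=a}^{b-1}\left(\lfloor g(m)\rfloor+\lfloor g(m+1)\rfloor\right).$$ "Decreasing" is meant in the weak sense (non-increasing). "Lipschitz with constant $c$" means $|g(z)-g(w)|\le c|z-w|$ for all $z,w$ in the interval. *)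

theory Defs
  imports "HOL-Analysis.Analysis"
begin

text \<open>The function is taken total on the reals; only its values at the integers of
  \<open>{a..b}\<close> enter. The index \<open>m\<close> ranges over integers, so the upper bound is exclusive.\<close>

definition trapezoidal_floor_sum :: "(real \<Rightarrow> real) \<Rightarrow> int \<Rightarrow> int \<Rightarrow> real" where
  "trapezoidal_floor_sum g a b =
     (1/2) * (\<Sum>m\<in>{a..<b}. real_of_int (\<lfloor>g (of_int m)\<rfloor> + \<lfloor>g (of_int (m + 1))\<rfloor>))"

end

theory Submission
  imports Defs
begin

text \<open>Each level \<open>K\<close> passed by \<open>\<lfloor>g\<rfloor>\<close> is attained at a point \<open>z\<close>, and \<open>[\<alpha>, \<beta>]\<close> is cut at these
  points rather than at the integers. By concavity the integral of \<open>g\<close> over a piece is at least the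
  trapezoid on its chord. If the piece has length \<open>L\<close> and drops by \<open>1\<close>, the Lipschitz condition
  gives \<open>c L \<ge> 1\<close>, so the gain \<open>(L - 1) / 2\<close> of the chord over the floor sum is at least
  \<open>(1 - c) L / 2\<close>. The positions of the crossings inside their unit steps only improve this.\<close>

lemma trapezoidal_floor_sum_split:
  assumes "a \<le> m" "m \<le> b"
  shows "trapezoidal_floor_sum g a b = trapezoidal_floor_sum g a m + trapezoidal_floor_sum g m b"
proof -
  have "{a..<b} = {a..<m} \<union> {m..<b}" using assms by auto
  then show ?thesis
    unfolding trapezoidal_floor_sum_def by (simp add: sum.union_disjoint distrib_left)
qed

lemma trapezoidal_floor_sum_step:
  "trapezoidal_floor_sum g m (m + 1) = (\<lfloor>g (of_int m)\<rfloor> + \<lfloor>g (of_int (m + 1))\<rfloor>) / 2"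
proof -
  have "{m..<m + 1} = {m}" by auto
  then show ?thesis unfolding trapezoidal_floor_sum_def by simp
qed

lemma trapezoidal_floor_sum_const:
  assumes "a \<le> b" and "\<And>m. a \<le> m \<Longrightarrow> m \<le> b \<Longrightarrow> \<lfloor>g (of_int m)\<rfloor> = K"
  shows "trapezoidal_floor_sum g a b = (of_int b - of_int a) * of_int K"
proof -
  have "(\<Sum>m\<in>{a..<b}. real_of_int (\<lfloor>g (of_int m)\<rfloor> + \<lfloor>g (of_int (m + 1))\<rfloor>))
      = (\<Sum>m\<in>{a..<b}. 2 * real_of_int K)"
    by (intro sum.cong refl) (use assms(2) in \<open>simp del: of_int_add\<close>)
  then show ?thesis
    using assms(1) unfolding trapezoidal_floor_sum_def by simp
qed

text \<open>The chord is an affine minorant of a concave function, and its integral is the area of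
  the trapezoid. The case \<open>a = b\<close> is separated because the slope divides by
  \<open>b - a\<close>.\<close>

lemma concave_integral_ge_chord:
  fixes g :: "real \<Rightarrow> real"
  assumes "concave_on {a..b} g" "continuous_on {a..b} g" "a \<le> b"
  shows "(b - a) * (g a + g b) / 2 \<le> integral {a..b} g"
proof (cases "a = b")
  case False
  with \<open>a \<le> b\<close> have "a < b" by simp
  define s where "s = (g b - g a) / (b - a)"
  have s: "s * (b - a) = g b - g a"
    using \<open>a < b\<close> by (simp add: s_def)
  have line: "((\<lambda>x. g a - s * a + s * x) has_integral
      (g a - s * a) * (b - a) + s * ((b\<^sup>2 - a\<^sup>2) / 2)) {a..b}"
    using has_integral_add[OF has_integral_const_real
        has_integral_mult_right[OF ident_has_integral[OF \<open>a \<le> b\<close>]], of "g a - s * a" s]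
      \<open>a \<le> b\<close> by (simp add: mult.commute)
  have "g a - s * a + s * x \<le> g x" if "x \<in> {a..b}" for x
  proof -
    have "convex_on {a..b} (\<lambda>x. - g x)"
      using assms(1) by (simp add: concave_on_def)
    moreover have slope: "(- g b - - g a) / (b - a) = - s"
      by (simp add: s_def minus_divide_left)
    ultimately have "- g x \<le> - s * (x - a) + - g a"
      using convex_onD_Icc'[of a b "\<lambda>x. - g x" x] that unfolding slope by blast
    then show ?thesis by (simp add: algebra_simps)
  qed
  then have "(g a - s * a) * (b - a) + s * ((b\<^sup>2 - a\<^sup>2) / 2) \<le> integral {a..b} g"
    using has_integral_le[OF line integrable_integral[OF integrable_continuous_real[OF assms(2)]]]
    by simp
  moreover have "(g a - s * a) * (b - a) + s * ((b\<^sup>2 - a\<^sup>2) / 2) = (b - a) * (g a + (g a + s * (b - a))) / 2"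
    by (simp add: field_simps power2_eq_square)
  ultimately show ?thesis using s by simp
qed simp

text \<open>The unit step from \<open>d\<close> to \<open>d + 1\<close> contributes (K + (K - 1)) /
  2 = K - 1/2 to the floor sum; the first summand is the share of it to the right of the crossing
  \<open>z\<close>. Prorating in this way lets the claim at one crossing follow from the claim at
  the next, one level lower. The induction is strong because any number of integers may lie between
  two crossings.\<close>

lemma trapezoidal_floor_sum_le_integral_from_crossing:
  fixes \<alpha> \<beta> d K :: int and g :: "real \<Rightarrow> real" and c z :: real
  assumes anti: "antimono_on {real_of_int \<alpha>..real_of_int \<beta>} g"
    and conc: "concave_on {real_of_int \<alpha>..real_of_int \<beta>} g"
    and c: "0 < c" "c < 1"
    and lip: "c-lipschitz_on {real_of_int \<alpha>..real_of_int \<beta>} g"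
    and "\<alpha> \<le> d" "d < \<beta>" "of_int d \<le> z" "z \<le> of_int d + 1"
    and "g z = of_int K" "\<lfloor>g (of_int (d + 1))\<rfloor> = K - 1"
  shows "(of_int d + 1 - z) * (of_int K - 1/2) + trapezoidal_floor_sum g (d + 1) \<beta>
      + (1 - c) / 2 * (of_int \<beta> - z) \<le> integral {z..of_int \<beta>} g"
  using assms(6-)
proof (induction "nat (\<beta> - d)" arbitrary: d z K rule: less_induct)
  case less
  note lz = \<open>of_int d \<le> z\<close> \<open>z \<le> of_int d + 1\<close> and gz = \<open>g z = of_int K\<close>
  have cont: "continuous_on {real_of_int \<alpha>..real_of_int \<beta>} g"
    using lip by (rule lipschitz_on_continuous_on)
  have sub: "{u..v} \<subseteq> {real_of_int \<alpha>..real_of_int \<beta>}" if "of_int d \<le> u" "v \<le> of_int \<beta>" for u v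
  proof -
    have "real_of_int \<alpha> \<le> of_int d" using \<open>\<alpha> \<le> d\<close> by simp
    then show ?thesis using that by auto
  qed
  have conc_sub: "concave_on {u..v} g" if "of_int d \<le> u" "v \<le> of_int \<beta>" for u v
    using conc convex_on_subset[OF _ sub[OF that]] by (simp add: concave_on_def)
  have chord: "(v - z) * (g z + g v) / 2 \<le> integral {z..v} g" if "z \<le> v" "v \<le> of_int \<beta>" for v
    using that sub[of z v] lz
    by (intro concave_integral_ge_chord continuous_on_subset[OF cont] conc_sub) auto
  have mono: "\<lfloor>g (of_int j)\<rfloor> \<le> \<lfloor>g (of_int i)\<rfloor>" if "\<alpha> \<le> i" "i \<le> j" "j \<le> \<beta>" for i j
    by (intro floor_mono monotone_onD[OF anti]) (use that in auto)
  have drop: "g x - g y \<le> c * (y - x)" if "of_int d \<le> x" "x \<le> y" "y \<le> of_int \<beta>" for x y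
    using lipschitz_onD[OF lip, of x y] sub[of x y] that by (auto simp: dist_real_def)
  \<comment> \<open>\<open>d'\<close> is the last integer at which the floor is still
    \<open>K - 1\<close>. Either it is \<beta> and no further level is left behind at an integer, or
    level \<open>K - 1\<close> is crossed in the unit step after \<open>d'\<close>.\<close>
  define A where "A = {m \<in> {d + 1..\<beta>}. \<lfloor>g (of_int m)\<rfloor> = K - 1}"
  define d' where "d' = Max A"
  have finA: "finite A" unfolding A_def by (rule finite_subset[of _ "{d + 1..\<beta>}"]) auto
  have "d + 1 \<in> A" using less.prems by (simp add: A_def)
  with finA have "d' \<in> A" unfolding d'_def by (intro Max_in) auto
  then have d': "d + 1 \<le> d'" "d' \<le> \<beta>" "\<lfloor>g (of_int d')\<rfloor> = K - 1" by (auto simp: A_def)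
  have "\<lfloor>g (of_int m)\<rfloor> = K - 1" if "d + 1 \<le> m" "m \<le> d'" for m
    using mono[of "d + 1" m] mono[of m d'] that d' less.prems by simp
  then have T1: "trapezoidal_floor_sum g (d + 1) d' = (of_int d' - of_int d - 1) * (of_int K - 1)"
    using trapezoidal_floor_sum_const[of "d + 1" d' g "K - 1"] d' by simp
  have gd': "of_int K - 1 \<le> g (of_int d')" using d'(3) by linarith
  show ?case
  proof (cases "d' = \<beta>")
    case True
    \<comment> \<open>The last piece need not drop by a full level: \<open>e\<close> is the height
      by which it ends above \<open>K - 1\<close>, and \<theta> is the position of \<open>z\<close>
      inside its unit step.\<close>
    define L where "L = of_int \<beta> - z"
    define e where "e = g (of_int \<beta>) - (of_int K - 1)"
    define \<theta> where "\<theta> = z - of_int d"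
    have th: "0 \<le> \<theta>" "\<theta> \<le> 1" using lz by (auto simp: \<theta>_def)
    have "real_of_int (d + 1) \<le> of_int \<beta>" using d' by linarith
    then have L: "1 - \<theta> \<le> L" "0 \<le> L" using lz by (auto simp: L_def \<theta>_def)
    have e: "0 \<le> e" using gd' True by (simp add: e_def)
    have "1 - e \<le> c * L"
      using drop[of z "of_int \<beta>"] lz L by (simp add: e_def gz L_def)
    \<comment> \<open>Twice the surplus of the chord's area over the claimed bound is eL + cL - (1 -
      \<theta>), so this is exactly what is needed. The Lipschitz bound 1 - e \<le> cL is multiplied
      by L when L \<le> 1, where cL * L \<le> cL and 1 - \<theta> \<le> L; for larger L it is used
      directly, since then e \<le> eL.\<close>
    have key: "1 - \<theta> \<le> e * L + c * L"
    proof (cases "L \<le> 1")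
      case True
      have "(1 - c * L) * L \<le> e * L"
        using \<open>1 - e \<le> c * L\<close> L by (intro mult_right_mono) auto
      moreover have "0 \<le> (c * L) * (1 - L)" using c L True by simp
      ultimately show ?thesis using L by (simp add: algebra_simps)
    next
      case False
      then have "e * 1 \<le> e * L" using e by (intro mult_left_mono) auto
      then show ?thesis using \<open>1 - e \<le> c * L\<close> th by simp
    qed
    have "(of_int d + 1 - z) * (of_int K - 1/2) + trapezoidal_floor_sum g (d + 1) \<beta>
        + (1 - c) / 2 * (of_int \<beta> - z)
      = L * (of_int K + (of_int K - 1 + e)) / 2 - (e * L + c * L - (1 - \<theta>)) / 2"
      using T1 True by (simp add: L_def \<theta>_def field_simps)
    also have "\<dots> \<le> L * (of_int K + (of_int K - 1 + e)) / 2" using key by simp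
    also have "\<dots> \<le> integral {z..of_int \<beta>} g"
      using chord[of "of_int \<beta>"] L by (simp add: gz e_def L_def)
    finally show ?thesis .
  next
    case False
    then have lt: "d' < \<beta>" using d' by simp
    have rd: "real_of_int d + 1 \<le> of_int d'" "real_of_int d' + 1 \<le> of_int \<beta>" using d' lt by linarith+
    have "\<lfloor>g (of_int (d' + 1))\<rfloor> \<noteq> K - 1"
    proof
      assume "\<lfloor>g (of_int (d' + 1))\<rfloor> = K - 1"
      then have "d' + 1 \<in> A" using d' lt by (simp add: A_def)
      then show False using Max_ge[OF finA] unfolding d'_def by fastforce
    qed
    then have below: "\<lfloor>g (of_int (d' + 1))\<rfloor> < K - 1"
      using mono[of d' "d' + 1"] d' lt \<open>\<alpha> \<le> d\<close> by simp
    \<comment> \<open>As c < 1, a unit step cannot skip a level, so the next crossing again has the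
      form required by the induction hypothesis.\<close>
    moreover have "g (of_int d') - 1 < g (of_int (d' + 1))"
      using drop[of "of_int d'" "of_int (d' + 1)"] rd c by simp
    ultimately have fl: "\<lfloor>g (of_int (d' + 1))\<rfloor> = K - 2" using gd' by linarith
    have "\<exists>x\<ge>of_int d'. x \<le> of_int d' + 1 \<and> g x = of_int K - 1"
    proof (rule IVT2')
      show "g (of_int d' + 1) \<le> of_int K - 1" using below by simp linarith
      show "continuous_on {of_int d'..of_int d' + 1} g"
        using sub[of "of_int d'" "of_int d' + 1"] rd by (intro continuous_on_subset[OF cont]) auto
    qed (use gd' in auto)
    then obtain z' where z': "of_int d' \<le> z'" "z' \<le> of_int d' + 1" "g z' = of_int K - 1" by blast
    have IH: "(of_int d' + 1 - z') * (of_int (K - 1) - 1/2) + trapezoidal_floor_sum g (d' + 1) \<beta>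
      + (1 - c) / 2 * (of_int \<beta> - z') \<le> integral {z'..of_int \<beta>} g"
      using z' fl lt d' \<open>\<alpha> \<le> d\<close> by (intro less.hyps) auto
    have zz: "z \<le> z'" "z' \<le> of_int \<beta>" using lz z' rd by auto
    \<comment> \<open>After subtracting the induction hypothesis and the chord's area on [z, z'],
      what remains to show is (d + 1 - z) - (z' - d') \<le> c(z' - z). The left side is at most 1,
      and the full drop from \<open>K\<close> to \<open>K - 1\<close> makes the right side at least
      1.\<close>
    have "1 \<le> c * (z' - z)" using drop[of z z'] zz lz z' gz by simp
    moreover have "(z' - z) * (of_int K + (of_int K - 1)) / 2 \<le> integral {z..z'} g"
      using chord[of z'] zz z' gz by simp
    moreover have "integral {z..z'} g + integral {z'..of_int \<beta>} g = integral {z..of_int \<beta>} g"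
      using zz sub[of z "of_int \<beta>"] lz
      by (intro Henstock_Kurzweil_Integration.integral_combine integrable_continuous_real
          continuous_on_subset[OF cont]) auto
    \<comment> \<open>The term K - 3/2 is the unit step after \<open>d'\<close>, where the floor
      falls from \<open>K - 1\<close> to \<open>K - 2\<close>.\<close>
    moreover have "trapezoidal_floor_sum g (d + 1) \<beta> = (of_int d' - of_int d - 1) * (of_int K - 1)
        + (of_int K - 3/2) + trapezoidal_floor_sum g (d' + 1) \<beta>"
      using trapezoidal_floor_sum_split[of "d + 1" d' \<beta> g] trapezoidal_floor_sum_split[of d' "d' + 1" \<beta> g]
        trapezoidal_floor_sum_step[of g d'] T1 d' lt fl by (simp add: field_simps)
    ultimately show ?thesis using IH lz z' by (simp add: field_simps)
  qed
qed

theorem theorem1p4: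
  fixes \<alpha> \<beta> p :: int and g :: "real \<Rightarrow> real" and c :: real
  assumes "\<alpha> < \<beta>"
    and "antimono_on {real_of_int \<alpha>..real_of_int \<beta>} g"
    and "concave_on {real_of_int \<alpha>..real_of_int \<beta>} g"
    and "0 < c" and "c < 1"
    and "c-lipschitz_on {real_of_int \<alpha>..real_of_int \<beta>} g"
    and "\<alpha> \<le> p" and "p < \<beta>"
    and "\<lfloor>g (real_of_int \<alpha>)\<rfloor> = \<lfloor>g (real_of_int p)\<rfloor>"
    and "\<lfloor>g (real_of_int p)\<rfloor> > \<lfloor>g (real_of_int (p + 1))\<rfloor>"
  shows "trapezoidal_floor_sum g \<alpha> \<beta>
      \<le> integral {real_of_int \<alpha>..real_of_int \<beta>} g - (1 - c) / 2 * real_of_int (\<beta> - p)"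
proof -
  note anti = assms(2) and conc = assms(3) and lip = assms(6)
  define N where "N = \<lfloor>g (of_int p)\<rfloor>"
  have cont: "continuous_on {real_of_int \<alpha>..real_of_int \<beta>} g"
    using lip by (rule lipschitz_on_continuous_on)
  have rp: "real_of_int \<alpha> \<le> of_int p" "real_of_int p + 1 \<le> of_int \<beta>"
    using \<open>\<alpha> \<le> p\<close> \<open>p < \<beta>\<close> by linarith+
  have anti': "g y \<le> g x" if "of_int \<alpha> \<le> x" "x \<le> y" "y \<le> of_int \<beta>" for x y
    by (rule monotone_onD[OF anti]) (use that in auto)
  have Np: "of_int N \<le> g (of_int p)" by (simp add: N_def)
  have "g (of_int p) - g (of_int (p + 1)) \<le> c"
    using lipschitz_onD[OF lip, of "of_int p" "of_int (p + 1)"] rp by (simp add: dist_real_def)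
  then have fl: "\<lfloor>g (of_int (p + 1))\<rfloor> = N - 1"
    using assms(5,10) Np unfolding N_def by linarith
  have "\<exists>x\<ge>of_int p. x \<le> of_int p + 1 \<and> g x = of_int N"
  proof (rule IVT2')
    show "g (of_int p + 1) \<le> of_int N" using fl by simp linarith
    show "continuous_on {of_int p..of_int p + 1} g"
      using rp by (intro continuous_on_subset[OF cont]) auto
  qed (use Np in auto)
  then obtain z where z: "of_int p \<le> z" "z \<le> of_int p + 1" "g z = of_int N" by blast
  have tail: "(of_int p + 1 - z) * (of_int N - 1/2) + trapezoidal_floor_sum g (p + 1) \<beta>
      + (1 - c) / 2 * (of_int \<beta> - z) \<le> integral {z..of_int \<beta>} g"
    using trapezoidal_floor_sum_le_integral_from_crossing[OF anti conc assms(4,5) lip assms(7,8) z fl] .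
  have zb: "of_int \<alpha> \<le> z" "z \<le> of_int \<beta>" using z rp by auto
  \<comment> \<open>Left of the first crossing no gain proportional to length is claimed, so
    monotonicity suffices: g is at least g z = N there.\<close>
  have "integral {of_int \<alpha>..z} (\<lambda>_. of_int N) \<le> integral {of_int \<alpha>..z} g"
    using zb z anti'[of _ z]
    by (intro integral_le integrable_continuous_real continuous_on_subset[OF cont]) auto
  then have head: "(z - of_int \<alpha>) * of_int N \<le> integral {of_int \<alpha>..z} g" using zb by simp
  have "\<lfloor>g (of_int m)\<rfloor> = N" if "\<alpha> \<le> m" "m \<le> p" for m
    using floor_mono[OF anti'[of "of_int \<alpha>" "of_int m"]] floor_mono[OF anti'[of "of_int m" "of_int p"]]
      that rp assms(9) by (simp add: N_def)
  then have "trapezoidal_floor_sum g \<alpha> p = (of_int p - of_int \<alpha>) * of_int N"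
    using \<open>\<alpha> \<le> p\<close> by (intro trapezoidal_floor_sum_const)
  then have "trapezoidal_floor_sum g \<alpha> \<beta> = (of_int p - of_int \<alpha>) * of_int N
      + (of_int N - 1/2) + trapezoidal_floor_sum g (p + 1) \<beta>"
    using trapezoidal_floor_sum_split[of \<alpha> p \<beta> g] trapezoidal_floor_sum_split[of p "p + 1" \<beta> g]
      trapezoidal_floor_sum_step[of g p] assms(7,8) fl by (simp add: N_def field_simps)
  moreover have "integral {of_int \<alpha>..z} g + integral {z..of_int \<beta>} g = integral {of_int \<alpha>..of_int \<beta>} g"
    using zb by (intro Henstock_Kurzweil_Integration.integral_combine integrable_continuous_real cont)
  \<comment> \<open>The tail yields a gain only over \<beta> - z. On [p, z] the head counts height N
    where the floor sum counts N - 1/2, which adds (z - p) / 2. This exceeds the missing (1 - c)(z -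
    p) / 2 by c(z - p) / 2.\<close>
  moreover have "0 \<le> c * (z - of_int p)" using z assms(4) by simp
  ultimately show ?thesis using tail head z by (simp add: field_simps)
qed

end
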